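(* Let $N\ge1$. Two nonzero matrices $M_1,M_2\in\mathrm{Mat}_{N+1}(k)$ have the same corner polyhedron, $\Pi_+(M_1)=\Pi_+(M_2)$, if and only if they have the same profile, $\mathrm{Prof}(M_1)=\mathrm{Prof}(M_2)$.
   Context: $k$ is an algebraically closed field. Let $\bar W\subset\mathbb{R}^{N+1}$ be the hyperplane of vectors whose coordinates sum to $0$; $e_1,\ldots,e_{N+1}$ are the standard basis vectors of $\mathbb{R}^{N+1}$. For $1\le j\le N$ let $s_j(x)=x_1+\cdots+x_j$, and let $O^+=\{w\in\bar W: s_j(w)\ge0\ \forall j\}$. The corner polyhedron of a nonzero $M=(M_{ij})$ is $$\Pi_+(M)=\mathrm{Conv}\{e_i-e_j: M_{ij}\ne0\}+O^+\subset\bar W$$ (Minkowski sum). Profiles. A path in an $(N+1)\times(N+1)$ matrix is a word in letters $\downarrow,\rightarrow$ with $N+1$ instances of each, identified with the lattice path of down- and right-directed unit segments in the gridlines between (and around) entries, from the top-left corner to the bottom-right corner of the matrix. A Dyck path is a path that does not cross the main diagonal (it may meet it). A lower Dyck path is a Dyck path beginning with $\downarrow$ (so it lies weakly below the main diagonal of the grid); an upper Dyck path is one beginning with $\rightarrow$ (lying weakly above it). A path contains $(i,j)$ if the entry $(i,j)$ lies above (i.e. to the upper right of) the path. The profile $\mathrm{Prof}(M)$ is: if $M$ is not strictly upper triangular, the lower Dyck path containing the fewest entries among all lower Dyck paths that contain all nonzero entries of $M$; if $M$ is strictly upper triangular, the upper Dyck path containing the fewest entries among all upper Dyck paths that contain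 all nonzero entries of $M$. *)

theory Defs
  imports "HOL-Analysis.Analysis"
begin

text \<open>
  Throughout, a linearly ordered finite type \<open>'n\<close> with \<open>CARD('n) = N + 1\<close> elements plays
  the role of the index set \<open>{1, \<dots>, N + 1}\<close>; \<open>pos\<close> is the unique order isomorphism onto it.
  The entry \<open>(i, j)\<close> of \<open>M\<close> (row \<open>i\<close>, column \<open>j\<close>) is \<open>M $ i $ j\<close>.
\<close>

definition pos :: "'n::{finite,linorder} \<Rightarrow> nat" where
  "pos i = card {..i}"

section \<open>Corner polyhedra\<close>

definition W_bar :: "(real ^ 'n::finite) set" where
  "W_bar = {x. (\<Sum>i\<in>UNIV. x $ i) = 0}"

definition psum :: "nat \<Rightarrow> real ^ 'n::{finite,linorder} \<Rightarrow> real" where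
  "psum j x = (\<Sum>i | pos i \<le> j. x $ i)"

definition O_plus :: "(real ^ 'n::{finite,linorder}) set" where
  "O_plus = {w \<in> W_bar. \<forall>j\<in>{1..CARD('n) - 1}. psum j w \<ge> 0}"

definition corner_polyhedron ::
    "'k::zero ^ 'n::{finite,linorder} ^ 'n::{finite,linorder} \<Rightarrow> (real ^ 'n::{finite,linorder}) set" where
  "corner_polyhedron M =
     convex hull {axis i 1 - axis j 1 | i j. M $ i $ j \<noteq> 0} + O_plus"

section \<open>Lattice paths\<close>

datatype step = Down | Right

definition is_path :: "nat \<Rightarrow> step list \<Rightarrow> bool" where
  "is_path n w \<longleftrightarrow> count_list w Down = n \<and> count_list w Right = n"

text \<open>
  The grid point reached after \<open>t\<close> steps, as (horizontal gridline, vertical gridline), both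
  numbered from \<open>0\<close>; the entry \<open>(i, j)\<close> is the unit square with opposite corners
  \<open>(i - 1, j - 1)\<close> and \<open>(i, j)\<close>, and the main diagonal consists of the points \<open>(r, r)\<close>.
\<close>

definition down_at :: "step list \<Rightarrow> nat \<Rightarrow> nat" where
  "down_at w t = count_list (take t w) Down"

definition right_at :: "step list \<Rightarrow> nat \<Rightarrow> nat" where
  "right_at w t = count_list (take t w) Right"

definition dyck_path :: "nat \<Rightarrow> step list \<Rightarrow> bool" where
  "dyck_path n w \<longleftrightarrow> is_path n w \<and>
     ((\<forall>t\<le>length w. right_at w t \<le> down_at w t) \<or>
      (\<forall>t\<le>length w. down_at w t \<le> right_at w t))"

definition lower_dyck_path :: "nat \<Rightarrow> step list \<Rightarrow> bool" where
  "lower_dyck_path n w \<longleftrightarrow> dyck_path n w \<and> w \<noteq> [] \<and> hd w = Down"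

definition upper_dyck_path :: "nat \<Rightarrow> step list \<Rightarrow> bool" where
  "upper_dyck_path n w \<longleftrightarrow> dyck_path n w \<and> w \<noteq> [] \<and> hd w = Right"

text \<open>
  An entry \<open>(i, j)\<close> is above (to the upper right of) the path iff it lies to the right of the
  unique down-segment of the path crossing row \<open>i\<close>.  If that segment is step \<open>t\<close> (counted
  from \<open>0\<close>), it runs along the vertical gridline \<open>right_at w t\<close>, and the left edge of the
  entry lies on the vertical gridline \<open>j - 1\<close>.
\<close>

definition entries_above :: "step list \<Rightarrow> (nat \<times> nat) set" where
  "entries_above w = {(i, j). i \<in> {1..count_list w Down} \<and> j \<in> {1..count_list w Right} \<and>
     (\<exists>t<length w. w ! t = Down \<and> down_at w t = i - 1 \<and> right_at w t \<le> j - 1)}"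

section \<open>Profiles\<close>

definition nonzero_entries :: "'k::zero ^ 'n::{finite,linorder} ^ 'n::{finite,linorder} \<Rightarrow> (nat \<times> nat) set" where
  "nonzero_entries M = {(pos i, pos j) | i j. M $ i $ j \<noteq> 0}"

definition strictly_upper_triangular :: "'k::zero ^ 'n::{finite,linorder} ^ 'n::{finite,linorder} \<Rightarrow> bool" where
  "strictly_upper_triangular M \<longleftrightarrow> (\<forall>i j. M $ i $ j \<noteq> 0 \<longrightarrow> i < j)"

text \<open>
  The minimiser is unique, since the admissible sets of entries above a path are closed under
  intersection and determine the path; so \<open>ARG_MIN\<close> involves no actual choice.
\<close>

definition profile :: "'k::zero ^ 'n::{finite,linorder} ^ 'n::{finite,linorder} \<Rightarrow> step list" where
  "profile M =
     (if strictly_upper_triangular M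
      then ARG_MIN (\<lambda>w. card (entries_above w)) w.
             upper_dyck_path CARD('n) w \<and> nonzero_entries M \<subseteq> entries_above w
      else ARG_MIN (\<lambda>w. card (entries_above w)) w.
             lower_dyck_path CARD('n) w \<and> nonzero_entries M \<subseteq> entries_above w)"

end

theory Submission
  imports Defs
begin

text \<open>
  Both invariants encode the closure of the support of \<open>M\<close> towards the upper right, enlarged by
  the weakly upper triangle if \<open>M\<close> is not strictly upper triangular.  This closure is the set of
  entries above the profile.  It is also the set of all \<open>(i, j)\<close> with \<open>e\<^sub>i - e\<^sub>j\<close> in the corner
  polyhedron: in the coordinates \<open>s\<^sub>l\<close> the vector \<open>e\<^sub>i - e\<^sub>j\<close> is plus or minus the indicator
  function of an interval, \<open>O\<^sup>+\<close> is the nonnegative orthant, and a vector outside the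
  polyhedron is cut off by a sum of suitable coordinates \<open>s\<^sub>l\<close>.
\<close>

section \<open>Positions and the closure of the support\<close>

lemma pos_less: "i < j \<Longrightarrow> pos i < pos (j :: 'n::{finite,linorder})"
  unfolding pos_def by (rule psubset_card_mono) auto

lemma pos_le_iff: "pos i \<le> pos j \<longleftrightarrow> i \<le> (j :: 'n::{finite,linorder})"
  by (metis pos_less leD leI order_le_less)

lemma pos_less_iff: "pos i < pos j \<longleftrightarrow> i < (j :: 'n::{finite,linorder})"
  by (meson pos_le_iff not_le)

lemma pos_eq_iff: "pos i = pos j \<longleftrightarrow> i = (j :: 'n::{finite,linorder})"
  by (metis pos_le_iff order_antisym order_refl)

lemma pos_image: "range (pos :: 'n::{finite,linorder} \<Rightarrow> nat) = {1..CARD('n)}"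
proof (rule card_subset_eq)
  show "range (pos :: 'n \<Rightarrow> nat) \<subseteq> {1..CARD('n)}"
    by (auto simp: pos_def Suc_le_eq card_gt_0_iff intro!: card_mono)
  show "card (range (pos :: 'n \<Rightarrow> nat)) = card {1..CARD('n)}"
    by (subst card_image) (auto simp: inj_on_def pos_eq_iff)
qed simp

lemma pos_bounds: "1 \<le> pos i" "pos (i :: 'n::{finite,linorder}) \<le> CARD('n)"
  using pos_image[where 'n='n] by (auto simp: set_eq_iff)

lemma pos_surj:
  assumes "1 \<le> l" "l \<le> CARD('n::{finite,linorder})"
  obtains i :: "'n::{finite,linorder}" where "pos i = l"
  using assms pos_image[where 'n='n] by (metis atLeastAtMost_iff imageE)

text \<open>The second disjunct has a reason on each side: a lower Dyck path has the whole weakly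
  upper triangle above it, and an entry \<open>(i', j')\<close> with \<open>j' \<le> i'\<close>
  satisfies \<open>e_j' - e_i' \<in> O_plus\<close>, so that its generator pulls 0, and then every
  \<open>e_i - e_j\<close> with \<open>i \<le> j\<close>, into the polyhedron.\<close>

definition support_closure ::
    "'k::zero ^ 'n::{finite,linorder} ^ 'n::{finite,linorder} \<Rightarrow> ('n \<times> 'n) set" where
  "support_closure M = {(i, j). (\<exists>i' j'. M $ i' $ j' \<noteq> 0 \<and> i \<le> i' \<and> j' \<le> j) \<or>
     (\<not> strictly_upper_triangular M \<and> i \<le> j)}"

lemma support_closure_mono:
  "(i', j') \<in> support_closure M \<Longrightarrow> i \<le> i' \<Longrightarrow> j' \<le> j \<Longrightarrow> (i, j) \<in> support_closure M"
  unfolding support_closure_def by (auto intro: order_trans)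

text \<open>The case distinction in \<open>profile\<close> can thus be read off from the closure
  alone.\<close>

lemma strictly_upper_triangular_iff_support_closure:
  "strictly_upper_triangular M \<longleftrightarrow> (\<forall>i. (i, i) \<notin> support_closure M)"
  unfolding support_closure_def strictly_upper_triangular_def
  by simp (meson leD le_less_trans order_refl)

section \<open>The corner polyhedron\<close>

lemma psum_add: "psum l (x + y) = psum l x + psum l y"
  by (simp add: psum_def sum.distrib)

lemma psum_diff: "psum l (x - y) = psum l x - psum l y"
  by (simp add: psum_def sum_subtractf)

lemma psum_axis:
  "psum l (axis i 1 :: real ^ 'n::{finite,linorder}) = of_bool (pos i \<le> l)"
  by (simp add: psum_def axis_def)

lemma psum_axis_diff:
  "psum l (axis i 1 - axis j 1 :: real ^ 'n::{finite,linorder}) =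
     of_bool (pos i \<le> l) - of_bool (pos j \<le> l)"
  by (simp add: psum_diff psum_axis)

lemma psum_scaleR: "psum l (c *\<^sub>R x) = c * psum l x"
  by (simp add: psum_def sum_distrib_left)

lemma axis_diff_in_W_bar: "axis i 1 - axis j 1 \<in> (W_bar :: (real ^ 'n::finite) set)"
  by (simp add: W_bar_def sum_subtractf axis_def)

lemma W_bar_diff: "x \<in> W_bar \<Longrightarrow> y \<in> W_bar \<Longrightarrow> x - y \<in> W_bar"
  by (simp add: W_bar_def sum_subtractf)

lemma O_plus_add: "x \<in> O_plus \<Longrightarrow> y \<in> O_plus \<Longrightarrow> x + y \<in> O_plus"
  by (auto simp: O_plus_def W_bar_def sum.distrib psum_add)

lemma convex_O_plus: "convex O_plus"
  by (rule convexI)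
    (auto simp: O_plus_def W_bar_def sum.distrib psum_add psum_scaleR sum_distrib_left[symmetric])

lemma convex_corner_polyhedron: "convex (corner_polyhedron M)"
  unfolding corner_polyhedron_def by (intro convex_set_plus convex_convex_hull convex_O_plus)

lemma corner_polyhedron_add:
  assumes "x \<in> corner_polyhedron M" "y \<in> O_plus"
  shows "x + y \<in> corner_polyhedron M"
proof -
  obtain a b where "x = a + b" and a: "a \<in> convex hull {axis i 1 - axis j 1 | i j. M $ i $ j \<noteq> 0}"
    and "b \<in> O_plus"
    using assms(1) unfolding corner_polyhedron_def by (rule set_plus_elim)
  then have eq: "x + y = a + (b + y)" and by_mem: "b + y \<in> O_plus"
    using assms(2) by (simp_all add: add.assoc O_plus_add)
  show ?thesis
    unfolding corner_polyhedron_def eq by (rule set_plus_intro[OF a by_mem])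
qed

text \<open>A sum of coordinates \<open>psum l\<close> is nonnegative on \<open>O_plus\<close>, so a
  lower bound on the generators extends to their convex hull and then to the Minkowski sum. These
  are the inequalities used for separation.\<close>

lemma corner_polyhedron_psum_sum_ge:
  fixes M :: "'k::zero ^ 'n::{finite,linorder} ^ 'n::{finite,linorder}"
  assumes "L \<subseteq> {1..CARD('n) - 1}"
    and "\<And>i j. M $ i $ j \<noteq> 0 \<Longrightarrow> c \<le> (\<Sum>l\<in>L. psum l (axis i 1 - axis j 1 :: (real, 'n) vec))"
    and "x \<in> corner_polyhedron M"
  shows "c \<le> (\<Sum>l\<in>L. psum l x)"
proof -
  let ?H = "{x. c \<le> (\<Sum>l\<in>L. psum l x)} :: ((real, 'n) vec) set"
  have "convex ?H"
  proof (rule convexI)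
    fix x y :: "(real, 'n) vec" and u v :: real
    assume xy: "x \<in> ?H" "y \<in> ?H" and uv: "0 \<le> u" "0 \<le> v" "u + v = 1"
    have "c = u * c + v * c"
      using uv(3) by (simp add: distrib_right[symmetric])
    also have "\<dots> \<le> u * (\<Sum>l\<in>L. psum l x) + v * (\<Sum>l\<in>L. psum l y)"
      using xy uv by (intro add_mono mult_left_mono) auto
    finally show "u *\<^sub>R x + v *\<^sub>R y \<in> ?H"
      by (simp add: psum_add psum_scaleR sum.distrib sum_distrib_left)
  qed
  then have hull: "convex hull {axis i 1 - axis j 1 | i j. M $ i $ j \<noteq> 0} \<subseteq> ?H"
    using assms(2) by (intro hull_minimal) auto
  obtain y z where yz: "x = y + z" "y \<in> ?H" "z \<in> O_plus"
    using assms(3) hull unfolding corner_polyhedron_def by (auto elim!: set_plus_elim)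
  have "0 \<le> (\<Sum>l\<in>L. psum l z)"
    using yz(3) assms(1) by (intro sum_nonneg) (auto simp: O_plus_def)
  then show ?thesis
    using yz by (simp add: psum_add sum.distrib)
qed

lemma axis_diff_in_corner_polyhedronI:
  assumes "M $ i' $ j' \<noteq> 0" and "i \<le> i' \<and> j' \<le> j \<or> i \<le> j \<and> j' \<le> i'"
  shows "axis i 1 - axis j 1 \<in> corner_polyhedron M"
proof -
  let ?v = "axis i' 1 - axis j' 1 :: real ^ _" and ?u = "axis i 1 - axis j 1 :: real ^ _"
  have "?v + 0 \<in> corner_polyhedron M"
    unfolding corner_polyhedron_def
    by (rule set_plus_intro[OF hull_inc])
      (use assms(1) in \<open>auto simp: O_plus_def W_bar_def psum_def\<close>)
  \<comment> \<open>The difference is \<open>(e_i - e_i') + (e_j' - e_j)\<close> in the first case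
    and \<open>(e_i - e_j) + (e_j' - e_i')\<close> in the second. In each bracket the index does not
    decrease, so no partial sum is negative.\<close>
  moreover have "?u - ?v \<in> O_plus"
    using assms(2) pos_le_iff[of i i'] pos_le_iff[of j' j] pos_le_iff[of i j] pos_le_iff[of j' i']
    by (auto simp: O_plus_def W_bar_diff axis_diff_in_W_bar psum_diff[of _ ?u] psum_axis_diff)
  ultimately show ?thesis
    using corner_polyhedron_add[of ?v M "?u - ?v"] by simp
qed

lemma axis_diff_in_corner_polyhedron_iff:
  fixes M :: "'k::zero ^ 'n::{finite,linorder} ^ 'n::{finite,linorder}"
  shows "axis i 1 - axis j 1 \<in> corner_polyhedron M \<longleftrightarrow> (i, j) \<in> support_closure M"
proof
  assume "(i, j) \<in> support_closure M"
  then show "axis i 1 - axis j 1 \<in> corner_polyhedron M"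
    unfolding support_closure_def strictly_upper_triangular_def
    by (auto simp: not_less intro: axis_diff_in_corner_polyhedronI)
next
  assume mem: "axis i 1 - axis j 1 \<in> corner_polyhedron M" (is "?v \<in> _")
  show "(i, j) \<in> support_closure M"
  proof (rule ccontr)
    assume nc: "(i, j) \<notin> support_closure M"
    have out: "pos i' < pos i \<or> pos j < pos j'" if "M $ i' $ j' \<noteq> 0" for i' j'
      using nc that unfolding support_closure_def pos_less_iff by (auto simp: not_le)
    show False
    proof (cases "strictly_upper_triangular M")
      case True
      \<comment> \<open>These are the coordinates in which \<open>?v\<close> is not positive. Each
        generator is here the indicator of an interval not contained in
        \<open>{pos i..<pos j}\<close>, so it contributes at least 1 on \<open>?L\<close>.\<close>
      let ?L = "{1..CARD('n) - 1} - {pos i..<pos j}"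
      have "1 \<le> (\<Sum>l\<in>?L. psum l (axis i' 1 - axis j' 1 :: (real, 'n) vec))"
        if nz: "M $ i' $ j' \<noteq> 0" for i' j'
      proof -
        have lt: "pos i' < pos j'"
          using True nz unfolding strictly_upper_triangular_def pos_less_iff by auto
        \<comment> \<open>An interval that leaves \<open>{pos i..<pos j}\<close> does so at one of
          its ends: the first point \<open>pos i'\<close> or the last point
          \<open>pos j' - 1\<close>.\<close>
        obtain l where l: "l \<in> ?L" "pos i' \<le> l" "l < pos j'"
        proof (cases "pos i' < pos i")
          case True
          then show ?thesis
            using that[of "pos i'"] lt pos_bounds[of i'] pos_bounds[of j'] by auto
        next
          case False
          then have "pos j \<le> pos j' - 1" "pos i' \<le> pos j' - 1" "1 \<le> pos j' - 1"
              "pos j' - 1 \<le> CARD('n) - 1" "pos j' - 1 < pos j'"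
            using out[OF nz] lt pos_bounds[of i'] pos_bounds[of j'] by linarith+
          then show ?thesis
            by (intro that[of "pos j' - 1"]) auto
        qed
        have "1 = psum l (axis i' 1 - axis j' 1 :: (real, 'n) vec)"
          using l by (simp add: psum_axis_diff)
        also have "\<dots> \<le> (\<Sum>l\<in>?L. psum l (axis i' 1 - axis j' 1 :: (real, 'n) vec))"
          using l lt by (intro member_le_sum) (auto simp: psum_axis_diff)
        finally show ?thesis .
      qed
      then have "1 \<le> (\<Sum>l\<in>?L. psum l ?v)"
        by (intro corner_polyhedron_psum_sum_ge[OF _ _ mem]) auto
      moreover have "(\<Sum>l\<in>?L. psum l ?v) \<le> 0"
        by (intro sum_nonpos) (auto simp: psum_axis_diff)
      ultimately show False by simp
    next
      case False
      \<comment> \<open>On this interval every coordinate of \<open>?v\<close> is -1, the least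
        value that any generator takes. No generator is -1 on all of it, so each generator has a sum
        exceeding that of \<open>?v\<close> by at least 1.\<close>
      let ?L = "{pos j..<pos i}"
      have lt: "pos j < pos i"
        using nc False unfolding support_closure_def pos_less_iff by auto
      have "1 - real (card ?L) \<le> (\<Sum>l\<in>?L. psum l (axis i' 1 - axis j' 1 :: (real, 'n) vec))"
        if nz: "M $ i' $ j' \<noteq> 0" for i' j'
      proof -
        \<comment> \<open>The generator can be negative only on \<open>{pos j'..<pos i'}\<close>,
          which misses the last or the first point of \<open>?L\<close>.\<close>
        obtain m where m: "m \<in> ?L" "pos i' \<le> m \<or> m < pos j'"
        proof (cases "pos i' < pos i")
          case True
          then have "pos j \<le> pos i - 1" "pos i - 1 < pos i" "pos i' \<le> pos i - 1"
            using lt by linarith+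
          then show ?thesis by (intro that[of "pos i - 1"]) auto
        next
          case False
          then show ?thesis using that[of "pos j"] out[OF nz] lt by auto
        qed
        have "1 - real (card ?L) = (\<Sum>l\<in>?L. of_bool (l = m) - 1)"
          using m by (simp add: sum_subtractf of_bool_def)
        also have "\<dots> \<le> (\<Sum>l\<in>?L. psum l (axis i' 1 - axis j' 1 :: (real, 'n) vec))"
          using m by (intro sum_mono) (auto simp: psum_axis_diff)
        finally show ?thesis .
      qed
      then have "1 - real (card ?L) \<le> (\<Sum>l\<in>?L. psum l ?v)"
        using pos_bounds[of j] pos_bounds[of i]
        by (intro corner_polyhedron_psum_sum_ge[OF _ _ mem]) auto
      moreover have "(\<Sum>l\<in>?L. psum l ?v) = (\<Sum>l\<in>?L. - 1)"
        by (intro sum.cong) (auto simp: psum_axis_diff)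
      ultimately show False by simp
    qed
  qed
qed

text \<open>Adding generators that already lie in the convex set \<open>corner_polyhedron M\<close>
  does not enlarge it. The polyhedron is therefore a function of the closure.\<close>

lemma corner_polyhedron_eq_support_closure:
  "corner_polyhedron M =
     convex hull {axis i 1 - axis j 1 | i j. (i, j) \<in> support_closure M} + O_plus"
    (is "_ = convex hull ?S + _")
proof
  show "corner_polyhedron M \<subseteq> convex hull ?S + O_plus"
    unfolding corner_polyhedron_def
    by (intro set_plus_mono2 hull_mono) (auto simp: support_closure_def)
  have "convex hull ?S \<subseteq> corner_polyhedron M"
    by (intro hull_minimal convex_corner_polyhedron)
      (auto simp: axis_diff_in_corner_polyhedron_iff)
  then show "convex hull ?S + O_plus \<subseteq> corner_polyhedron M"
    by (auto elim!: set_plus_elim intro: corner_polyhedron_add)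
qed

lemma corner_polyhedron_eq_iff:
  "corner_polyhedron M1 = corner_polyhedron M2 \<longleftrightarrow> support_closure M1 = support_closure M2"
proof
  assume "corner_polyhedron M1 = corner_polyhedron M2"
  then show "support_closure M1 = support_closure M2"
    by (auto simp: axis_diff_in_corner_polyhedron_iff[symmetric])
next
  assume "support_closure M1 = support_closure M2"
  then show "corner_polyhedron M1 = corner_polyhedron M2"
    by (simp add: corner_polyhedron_eq_support_closure)
qed

section \<open>Lattice paths\<close>

lemma down_at_mono: "t \<le> u \<Longrightarrow> down_at w t \<le> down_at w u"
  unfolding down_at_def by (metis count_list_append le_add1 le_Suc_ex take_add)

lemma right_at_mono: "t \<le> u \<Longrightarrow> right_at w t \<le> right_at w u"
  unfolding right_at_def by (metis count_list_append le_add1 le_Suc_ex take_add)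

lemma down_at_Suc: "t < length w \<Longrightarrow> w ! t = Down \<Longrightarrow> down_at w (Suc t) = Suc (down_at w t)"
  by (simp add: down_at_def take_Suc_conv_app_nth)

text \<open>The induction appends steps at the end because \<open>down_at\<close> looks at prefixes
  only, so earlier steps keep their values.\<close>

lemma down_step_exists:
  "d < count_list w Down \<Longrightarrow> \<exists>t<length w. w ! t = Down \<and> down_at w t = d"
proof (induction w rule: rev_induct)
  case (snoc x w)
  show ?case
  proof (cases "d < count_list w Down")
    case True
    then obtain t where "t < length w" "w ! t = Down" "down_at w t = d"
      using snoc.IH by blast
    then show ?thesis
      by (intro exI[of _ t]) (auto simp: nth_append down_at_def)
  next
    case False
    then show ?thesis
      using snoc.prems by (intro exI[of _ "length w"]) (auto simp: down_at_def split: if_splits)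
  qed
qed simp

text \<open>The path crosses row \<open>i\<close> no later than row \<open>i'\<close>, hence no
  further to the right.\<close>

lemma entries_above_mono:
  assumes "(i', j') \<in> entries_above w" "1 \<le> i" "i \<le> i'" "j' \<le> j" "j \<le> count_list w Right"
  shows "(i, j) \<in> entries_above w"
proof -
  obtain t' where t': "t' < length w" "w ! t' = Down" "down_at w t' = i' - 1" "right_at w t' \<le> j' - 1"
    and bounds: "1 \<le> i'" "i' \<le> count_list w Down" "1 \<le> j'"
    using assms(1) by (auto simp: entries_above_def)
  have "i - 1 < count_list w Down"
    using bounds assms by linarith
  then obtain t where t: "t < length w" "w ! t = Down" "down_at w t = i - 1"
    using down_step_exists by blast
  have "t \<le> t'"
  proof (rule ccontr)
    assume "\<not> t \<le> t'"
    then have "down_at w (Suc t') \<le> down_at w t" by (intro down_at_mono) simp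
    then show False using t t' down_at_Suc[of t' w] assms bounds by simp
  qed
  then have "right_at w t \<le> j - 1"
    using right_at_mono[of t t' w] t' assms by simp
  then show ?thesis
    using t bounds assms unfolding entries_above_def by auto
qed

section \<open>Dyck paths\<close>

lemma lower_dyck_path_iff:
  "lower_dyck_path n w \<longleftrightarrow> is_path n w \<and> w \<noteq> [] \<and> (\<forall>t\<le>length w. right_at w t \<le> down_at w t)"
proof (cases w)
  case (Cons s w')
  \<comment> \<open>After one step the path is off the diagonal, so the first letter decides which
    disjunct of \<open>dyck_path\<close> can hold.\<close>
  then have "1 \<le> length w" "down_at w 1 = of_bool (s = Down)" "right_at w 1 = of_bool (s = Right)"
    by (auto simp: down_at_def right_at_def)
  then show ?thesis
    unfolding lower_dyck_path_def dyck_path_def using Cons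
    by (cases s) (auto dest: spec[of _ 1])
qed (simp add: lower_dyck_path_def)

lemma upper_dyck_path_iff:
  "upper_dyck_path n w \<longleftrightarrow> is_path n w \<and> w \<noteq> [] \<and> (\<forall>t\<le>length w. down_at w t \<le> right_at w t)"
proof (cases w)
  case (Cons s w')
  then have "1 \<le> length w" "down_at w 1 = of_bool (s = Down)" "right_at w 1 = of_bool (s = Right)"
    by (auto simp: down_at_def right_at_def)
  then show ?thesis
    unfolding upper_dyck_path_def dyck_path_def using Cons
    by (cases s) (auto dest: spec[of _ 1])
qed (simp add: upper_dyck_path_def)

text \<open>The down step in row \<open>i\<close> starts at height \<open>i - 1\<close>, so it lies
  on a vertical gridline numbered at most \<open>i - 1\<close>.\<close>

lemma entries_above_lower_dyck_path:
  assumes "lower_dyck_path n w" "1 \<le> i" "i \<le> j" "j \<le> n"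
  shows "(i, j) \<in> entries_above w"
proof -
  have cnt: "count_list w Down = n" "count_list w Right = n"
    using assms(1) by (auto simp: lower_dyck_path_iff is_path_def)
  have "i - 1 < count_list w Down"
    using cnt assms by linarith
  then obtain t where t: "t < length w" "w ! t = Down" "down_at w t = i - 1"
    using down_step_exists by blast
  have "right_at w t \<le> down_at w t"
    using assms(1) t(1) by (simp add: lower_dyck_path_iff)
  then have "right_at w t \<le> j - 1"
    using t(3) assms(3) by linarith
  then show ?thesis
    using t cnt assms unfolding entries_above_def by auto
qed

text \<open>Here \<open>r i\<close> is the vertical gridline along which row \<open>i\<close> is
  crossed, \<open>r 0\<close> the starting gridline and \<open>r (Suc n)\<close> the final one. The
  bounds on \<open>right_at\<close> hold at all points of the path and later yield the Dyck
  conditions.\<close>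

lemma path_of_thresholds:
  fixes r :: "nat \<Rightarrow> nat"
  assumes "r 0 = 0" "\<forall>i\<le>n. r i \<le> r (Suc i)"
  shows "\<exists>w. count_list w Down = n \<and> count_list w Right = r (Suc n) \<and>
    (\<forall>t\<le>length w. r (down_at w t) \<le> right_at w t \<and> right_at w t \<le> r (Suc (down_at w t))) \<and>
    (\<forall>d s. (\<exists>t<length w. w ! t = Down \<and> down_at w t = d \<and> right_at w t = s) \<longleftrightarrow>
      d < n \<and> s = r (Suc d))"
  using assms(2)
proof (induction n)
  case 0
  have [simp]: "count_list (replicate m x) y = of_bool (x = y) * m" for m and x y :: step
    by (induction m) auto
  show ?case
    using assms(1)
    by (intro exI[of _ "replicate (r 1) Right"]) (auto simp: down_at_def right_at_def)
next
  case (Suc n)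
  have [simp]: "count_list (replicate m x) y = of_bool (x = y) * m" for m and x y :: step
    by (induction m) auto
  have prem: "\<forall>i\<le>n. r i \<le> r (Suc i)"
    using Suc.prems by simp
  from Suc.IH[OF prem] obtain w where "count_list w Down = n" "count_list w Right = r (Suc n)"
      "\<forall>t\<le>length w. r (down_at w t) \<le> right_at w t \<and> right_at w t \<le> r (Suc (down_at w t))"
      "\<forall>d s. (\<exists>t<length w. w ! t = Down \<and> down_at w t = d \<and> right_at w t = s) \<longleftrightarrow>
        d < n \<and> s = r (Suc d)"
    by (elim exE conjE)
  note w = this[rule_format]
  have mono: "r (Suc n) \<le> r (Suc (Suc n))"
    using Suc.prems by simp
  \<comment> \<open>The old path ends on gridline \<open>r (Suc n)\<close>, where the new row is
    crossed. The remaining right steps lead to the new final gridline.\<close>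
  let ?k = "r (Suc (Suc n)) - r (Suc n)"
  let ?w = "w @ Down # replicate ?k Right"
  have old: "down_at ?w t = down_at w t" "right_at ?w t = right_at w t" if "t \<le> length w" for t
    using that by (auto simp: down_at_def right_at_def)
  \<comment> \<open>The minimum covers prefix lengths beyond the end of the path.\<close>
  have new: "down_at ?w (Suc (length w + u)) = Suc n"
      "right_at ?w (Suc (length w + u)) = r (Suc n) + min u ?k" for u
    using w by (auto simp: down_at_def right_at_def)
  have between: "r (down_at ?w t) \<le> right_at ?w t \<and> right_at ?w t \<le> r (Suc (down_at ?w t))" for t
  proof (cases "t \<le> length w")
    case True
    then show ?thesis using w(3) old by simp
  next
    case False
    then obtain u where "t = Suc (length w + u)" by (metis less_imp_Suc_add not_le)
    then show ?thesis using new mono by simp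
  qed
  have steps: "(\<exists>t<length ?w. ?w ! t = Down \<and> down_at ?w t = d \<and> right_at ?w t = s) \<longleftrightarrow>
      d < Suc n \<and> s = r (Suc d)" for d s
  proof -
    have down_iff: "t < length ?w \<and> ?w ! t = Down \<longleftrightarrow> t < length w \<and> w ! t = Down \<or> t = length w" for t
      by (auto simp: nth_append nth_Cons split: nat.split)
    have "(\<exists>t<length ?w. ?w ! t = Down \<and> down_at ?w t = d \<and> right_at ?w t = s) \<longleftrightarrow>
        (\<exists>t. (t < length w \<and> w ! t = Down \<or> t = length w) \<and> down_at ?w t = d \<and> right_at ?w t = s)"
      unfolding down_iff[symmetric] by (simp only: conj_assoc)
    also have "\<dots> \<longleftrightarrow> (\<exists>t<length w. w ! t = Down \<and> down_at w t = d \<and> right_at w t = s) \<or>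
        down_at w (length w) = d \<and> right_at w (length w) = s"
      using old by (metis less_imp_le order_refl)
    also have "\<dots> \<longleftrightarrow> d < n \<and> s = r (Suc d) \<or> n = d \<and> r (Suc n) = s"
      unfolding w(4) using w(1,2) by (simp add: down_at_def right_at_def)
    also have "\<dots> \<longleftrightarrow> d < Suc n \<and> s = r (Suc d)"
      by (auto simp: less_Suc_eq)
    finally show ?thesis .
  qed
  have counts: "count_list ?w Down = Suc n" "count_list ?w Right = r (Suc (Suc n))"
    by (simp_all add: w(1,2) mono)
  show ?case
    by (rule exI[of _ ?w], intro conjI allI impI)
      (rule counts between[THEN conjunct1] between[THEN conjunct2] steps)+
qed

text \<open>Each row of \<open>V\<close> is a final segment of the row, and these segments shrink
  from top to bottom. Their left ends are the thresholds of a path.\<close>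

lemma path_of_closed_set:
  assumes "n \<ge> 1" and "V \<subseteq> {1..n} \<times> {1..n}"
    and closed: "\<And>i i' j j'. (i', j') \<in> V \<Longrightarrow> 1 \<le> i \<Longrightarrow> i \<le> i' \<Longrightarrow> j' \<le> j \<Longrightarrow> j \<le> n \<Longrightarrow> (i, j) \<in> V"
  shows "\<exists>w. entries_above w = V \<and>
    ((\<forall>i\<in>{1..n}. (i, i) \<in> V) \<longrightarrow> lower_dyck_path n w) \<and>
    ((\<forall>i\<in>{1..n}. (i, i) \<notin> V) \<longrightarrow> upper_dyck_path n w)"
proof -
  \<comment> \<open>This counts the entries of row \<open>i\<close> to the left of \<open>V\<close>.
    Row \<open>n + 1\<close> contains no element of \<open>V\<close>, which gives the correct final
    gridline \<open>n\<close>.\<close>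
  define r where "r i = (if i = 0 then 0 else card {j\<in>{1..n}. (i, j) \<notin> V})" for i
  have r0: "r 0 = 0" by (simp add: r_def)
  have rn: "r (Suc n) = n"
  proof -
    have "{j\<in>{1..n}. (Suc n, j) \<notin> V} = {1..n}" using assms(2) by auto
    then show ?thesis by (simp add: r_def)
  qed
  have mono: "r i \<le> r (Suc i)" for i
  proof (cases "i = 0")
    case False
    then have "{j\<in>{1..n}. (i, j) \<notin> V} \<subseteq> {j\<in>{1..n}. (Suc i, j) \<notin> V}"
      using closed[of "Suc i" _ i] by auto
    then show ?thesis using False by (auto simp: r_def intro: card_mono)
  qed (simp add: r0)
  have r_less: "r i < j \<longleftrightarrow> (i, j) \<in> V" if "i \<in> {1..n}" "j \<in> {1..n}" for i j
  proof
    assume "(i, j) \<in> V"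
    then have "{j\<in>{1..n}. (i, j) \<notin> V} \<subseteq> {1..<j}"
      using closed[of i j i] that by (force simp: not_le[symmetric])
    then have "r i \<le> card {1..<j}"
      using card_mono[of "{1..<j}"] that by (simp add: r_def)
    then show "r i < j" using that by auto
  next
    assume less: "r i < j"
    show "(i, j) \<in> V"
    proof (rule ccontr)
      assume "(i, j) \<notin> V"
      then have "{1..j} \<subseteq> {j\<in>{1..n}. (i, j) \<notin> V}"
        using closed[of i _ i j] that by auto
      then have "card {1..j} \<le> r i"
        using card_mono[of "{j\<in>{1..n}. (i, j) \<notin> V}" "{1..j}"] that by (simp add: r_def)
      then show False using less by simp
    qed
  qed
  obtain w where w: "count_list w Down = n" "count_list w Right = n"
      "\<And>t. t \<le> length w \<Longrightarrow> r (down_at w t) \<le> right_at w t \<and> right_at w t \<le> r (Suc (down_at w t))"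
      "\<And>d s. (\<exists>t<length w. w ! t = Down \<and> down_at w t = d \<and> right_at w t = s) \<longleftrightarrow>
        d < n \<and> s = r (Suc d)"
    using path_of_thresholds[of r n, OF r0] mono unfolding rn by metis
  have ne: "w \<noteq> []" using w(1) assms(1) by auto
  have dn: "down_at w t \<le> n" "right_at w t \<le> n" for t
    using down_at_mono[of t "max t (length w)" w] right_at_mono[of t "max t (length w)" w] w(1,2)
    by (auto simp: down_at_def right_at_def)
  have "(i, j) \<in> entries_above w \<longleftrightarrow> (i, j) \<in> V" for i j
  proof (cases "i \<in> {1..n} \<and> j \<in> {1..n}")
    case True
    have "(i, j) \<in> entries_above w \<longleftrightarrow>
        (\<exists>s. (\<exists>t<length w. w ! t = Down \<and> down_at w t = i - 1 \<and> right_at w t = s) \<and> s \<le> j - 1)"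
      using True w(1,2) unfolding entries_above_def by auto
    also have "\<dots> \<longleftrightarrow> r i < j" unfolding w(4) using True by auto
    finally show ?thesis using r_less True by simp
  next
    case False
    then show ?thesis using assms(2) w(1,2) unfolding entries_above_def by auto
  qed
  moreover have "lower_dyck_path n w" if diag: "\<forall>i\<in>{1..n}. (i, i) \<in> V"
  proof -
    \<comment> \<open>The upper threshold bound is used: the diagonal entry of the next row is in
      \<open>V\<close>, so \<open>r (Suc d) \<le> d\<close> at height \<open>d < n\<close>.\<close>
    have "right_at w t \<le> down_at w t" if "t \<le> length w" for t
    proof (cases "down_at w t < n")
      case True
      then have "r (Suc (down_at w t)) < Suc (down_at w t)"
        using diag by (subst r_less) auto
      then show ?thesis using w(3)[OF that] by simp
    next
      case False
      then show ?thesis using dn(2)[of t] by simp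
    qed
    then show ?thesis using ne w(1,2) by (simp add: lower_dyck_path_iff is_path_def)
  qed
  moreover have "upper_dyck_path n w" if diag: "\<forall>i\<in>{1..n}. (i, i) \<notin> V"
  proof -
    \<comment> \<open>The lower threshold bound is used: the diagonal entry of the row just crossed
      is outside \<open>V\<close>, so \<open>d \<le> r d\<close> at height
      \<open>d > 0\<close>.\<close>
    have "down_at w t \<le> right_at w t" if "t \<le> length w" for t
    proof (cases "down_at w t = 0")
      case False
      then have "\<not> r (down_at w t) < down_at w t"
        using diag dn(1)[of t] by (subst r_less) auto
      then show ?thesis using w(3)[OF that] by simp
    qed simp
    then show ?thesis using ne w(1,2) by (simp add: upper_dyck_path_iff is_path_def)
  qed
  ultimately show ?thesis by (intro exI[of _ w]) auto
qed

section \<open>Profiles\<close>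

definition closure_entries ::
    "'k::zero ^ 'n::{finite,linorder} ^ 'n::{finite,linorder} \<Rightarrow> (nat \<times> nat) set" where
  "closure_entries M = map_prod pos pos ` support_closure M"

lemma closure_entries_pos_iff: "(pos i, pos j) \<in> closure_entries M \<longleftrightarrow> (i, j) \<in> support_closure M"
  unfolding closure_entries_def by (auto simp: pos_eq_iff)

lemma closure_entries_eq_iff:
  "closure_entries M1 = closure_entries M2 \<longleftrightarrow> support_closure M1 = support_closure M2"
  unfolding closure_entries_def
  by (rule inj_image_eq_iff) (auto simp: inj_on_def pos_eq_iff)

lemma closure_entries_subset:
  fixes M :: "'k::zero ^ 'n::{finite,linorder} ^ 'n::{finite,linorder}"
  shows "closure_entries M \<subseteq> {1..CARD('n)} \<times> {1..CARD('n)}"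
  using pos_bounds[where 'n='n] unfolding closure_entries_def by auto

definition admissible ::
    "'k::zero ^ 'n::{finite,linorder} ^ 'n::{finite,linorder} \<Rightarrow> step list \<Rightarrow> bool" where
  "admissible M w \<longleftrightarrow>
     (if strictly_upper_triangular M then upper_dyck_path CARD('n) w else lower_dyck_path CARD('n) w)"

text \<open>The entries above a path are closed towards the upper right and, for a lower Dyck path,
  contain the weakly upper triangle. These are the two ways in which the closure extends the
  support.\<close>

lemma nonzero_entries_subset_iff:
  fixes M :: "'k::zero ^ 'n::{finite,linorder} ^ 'n::{finite,linorder}"
  assumes adm: "admissible M w"
  shows "nonzero_entries M \<subseteq> entries_above w \<longleftrightarrow> closure_entries M \<subseteq> entries_above w"
proof
  assume "closure_entries M \<subseteq> entries_above w"
  moreover have "nonzero_entries M \<subseteq> closure_entries M"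
    unfolding nonzero_entries_def
    by (auto simp: closure_entries_pos_iff) (auto simp: support_closure_def)
  ultimately show "nonzero_entries M \<subseteq> entries_above w" by blast
next
  assume sub: "nonzero_entries M \<subseteq> entries_above w"
  have cnt: "count_list w Right = CARD('n)"
    using adm unfolding admissible_def
    by (auto simp: lower_dyck_path_iff upper_dyck_path_iff is_path_def split: if_splits)
  have "(pos i, pos j) \<in> entries_above w" if "(i, j) \<in> support_closure M" for i j
    using that unfolding support_closure_def
  proof (clarsimp, elim disjE exE conjE)
    fix i' j' assume "M $ i' $ j' \<noteq> 0" "i \<le> i'" "j' \<le> j"
    moreover from this have "(pos i', pos j') \<in> entries_above w"
      using sub by (auto simp: nonzero_entries_def)
    ultimately show ?thesis
      using pos_bounds[of i] pos_bounds[of j] cnt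
      by (auto intro: entries_above_mono simp: pos_le_iff)
  next
    assume "\<not> strictly_upper_triangular M" "i \<le> j"
    then show ?thesis
      using adm pos_bounds[of i] pos_bounds[of j]
      by (auto simp: admissible_def pos_le_iff intro: entries_above_lower_dyck_path)
  qed
  then show "closure_entries M \<subseteq> entries_above w"
    unfolding closure_entries_def by auto
qed

lemma profile_eq_arg_min:
  "profile M =
     (ARG_MIN (\<lambda>w. card (entries_above w)) w. admissible M w \<and> closure_entries M \<subseteq> entries_above w)"
  unfolding profile_def
  by (simp add: nonzero_entries_subset_iff[symmetric] admissible_def cong: conj_cong)

lemma finite_entries_above: "finite (entries_above w)"
  by (rule finite_subset[of _ "{1..count_list w Down} \<times> {1..count_list w Right}"])
    (auto simp: entries_above_def)

text \<open>The closure is itself the set of entries above some admissible path, so a minimiser has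
  at most that many entries above it. As it contains the closure, finiteness forces
  equality.\<close>

lemma entries_above_profile:
  fixes M :: "'k::zero ^ 'n::{finite,linorder} ^ 'n::{finite,linorder}"
  shows "entries_above (profile M) = closure_entries M"
proof -
  let ?n = "CARD('n)"
  let ?P = "\<lambda>w. admissible M w \<and> closure_entries M \<subseteq> entries_above w"
  have closed: "(i, j) \<in> closure_entries M"
    if "(i', j') \<in> closure_entries M" "1 \<le> i" "i \<le> i'" "j' \<le> j" "j \<le> ?n" for i i' j j'
  proof -
    have "i \<le> ?n" "1 \<le> j" using that closure_entries_subset[of M] by force+
    obtain a b :: 'n where ab: "pos a = i" "pos b = j"
      using pos_surj \<open>1 \<le> i\<close> \<open>i \<le> ?n\<close> \<open>1 \<le> j\<close> \<open>j \<le> ?n\<close> by metis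
    obtain c d :: 'n where "i' = pos c" "j' = pos d" "(c, d) \<in> support_closure M"
      using \<open>(i', j') \<in> closure_entries M\<close> by (auto simp: closure_entries_def)
    then show ?thesis
      using that ab by (auto simp: closure_entries_pos_iff pos_le_iff intro: support_closure_mono)
  qed
  have diag: "(\<forall>i\<in>{1..?n}. (i, i) \<in> closure_entries M)" if "\<not> strictly_upper_triangular M"
    using that pos_image[where 'n='n, symmetric]
    by (auto simp: closure_entries_pos_iff support_closure_def)
  have nodiag: "(\<forall>i\<in>{1..?n}. (i, i) \<notin> closure_entries M)" if "strictly_upper_triangular M"
    using that pos_image[where 'n='n, symmetric]
    by (auto simp: closure_entries_pos_iff strictly_upper_triangular_iff_support_closure)
  have "?n \<ge> 1" by (simp add: Suc_le_eq)
  then have "\<exists>w. entries_above w = closure_entries M \<and>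
    ((\<forall>i\<in>{1..?n}. (i, i) \<in> closure_entries M) \<longrightarrow> lower_dyck_path ?n w) \<and>
    ((\<forall>i\<in>{1..?n}. (i, i) \<notin> closure_entries M) \<longrightarrow> upper_dyck_path ?n w)"
    by (rule path_of_closed_set[OF _ closure_entries_subset]) (rule closed)
  then obtain w where w: "entries_above w = closure_entries M" "admissible M w"
    unfolding admissible_def using diag nodiag by metis
  then have P: "?P w" by simp
  have "?P (profile M)"
    unfolding profile_eq_arg_min using arg_min_natI[of ?P, OF P] .
  moreover have "card (entries_above (profile M)) \<le> card (closure_entries M)"
    unfolding profile_eq_arg_min w(1)[symmetric]
    using arg_min_nat_le[of ?P, OF P, of "\<lambda>w. card (entries_above w)"] unfolding w(1) .
  ultimately show ?thesis
    by (metis card_seteq finite_entries_above)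
qed

lemma profile_eq_iff:
  fixes M1 M2 :: "'k::zero ^ 'n::{finite,linorder} ^ 'n::{finite,linorder}"
  shows "profile M1 = profile M2 \<longleftrightarrow> support_closure M1 = support_closure M2"
proof
  assume "profile M1 = profile M2"
  then show "support_closure M1 = support_closure M2"
    by (metis entries_above_profile closure_entries_eq_iff)
next
  assume eq: "support_closure M1 = support_closure M2"
  \<comment> \<open>Now both profiles are \<open>ARG_MIN\<close> of the same function over the same
    predicate, hence the same path.\<close>
  then have "admissible M1 = admissible M2"
    by (simp add: fun_eq_iff admissible_def strictly_upper_triangular_iff_support_closure)
  then show "profile M1 = profile M2"
    using eq by (simp add: profile_eq_arg_min closure_entries_def)
qed

theorem corollary3p19:
  fixes N :: nat
    and M1 M2 :: "'k::alg_closed_field ^ 'n::{finite,linorder} ^ 'n::{finite,linorder}"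
  assumes "N \<ge> 1" and "CARD('n) = N + 1"
    and "M1 \<noteq> 0" and "M2 \<noteq> 0"
  shows "corner_polyhedron M1 = corner_polyhedron M2 \<longleftrightarrow> profile M1 = profile M2"
  by (simp add: corner_polyhedron_eq_iff profile_eq_iff)

end
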